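(* For the cubillage $Q$ on $Z(4,3)$ that contains the vertex $13=\{1,3\}$, the set $V_Q$ is neither s-pure nor w-pure.
   Context: Notation: $[n]=\{1,\ldots,n\}$; $A-B=\{a\in A: a\notin B\}$. Separation: for $A,B\subseteq[n]$ write $A<B$ if $\max(A)<\min(B)$ (with $\max(\emptyset)=\min(\emptyset)=0$). $A,B$ are strongly separated if $A=B$ or $(A-B)<(B-A)$ or $(B-A)<(A-B)$. $A$ surrounds $B$ if there are no $i<j<k$ in $[n]$ with $i,k\in B-A$ and $j\in A-B$; $A,B$ are weakly separated if either $|A|\le|B|$ and $A$ surrounds $B$, or $|B|\le|A|$ and $B$ surrounds $A$ (or both). A collection is an s-collection (w-collection) if any two of its members are strongly (weakly) separated. A domain $\mathcal D\subseteq2^{[n]}$ is s-pure (w-pure) if all inclusion-wise maximal s-collections (resp. w-collections) contained in $\mathcal D$ have the same cardinality. Zonotope and cubillages (here $n=4$): $\theta_i=(x_i,y_i,1)\in\mathbb R^3$, $i=1,\ldots,n$, are fixed vectors with $x_1<\cdots<x_n$ and the points $(x_i,y_i)$ in strictly convex position forming a lower convex chain (for $i<j<k$, $(x_j,y_j)$ lies strictly below the segment joining $(x_i,y_i)$ and $(x_k,y_k)$; e.g. $y_i=x_i^2$); the $\theta_i$ are assumed $\mathbb Z$-independent. $Z=Z(n,3)$ is the Minkowski sum of the segments $[0,\theta_i]$. A subset $X\subseteq[n]$ is identified with the point $\sum_{i\in X}\theta_i$. For $i<j<k$, $X\subseteq[n]-\{i,j,k\}$, the cube $\zeta(X|ijk)$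 is $X+\{\lambda\theta_i+\lambda'\theta_j+\lambda''\theta_k:0\le\lambda,\lambda',\lambda''\le1\}$. A cubillage $Q$ on $Z$ is a subdivision of $Z$ into cubes of this form such that any two intersect only by a common face and any face of the boundary of $Z$ is a face of some cube. $V_Q\subseteq2^{[n]}$ is its set of vertices, regarded as subsets of $[n]$. There are exactly two cubillages on $Z(4,3)$: one having $\{1,3\}$ as a vertex and the other having $\{2,4\}$. *)

theory Defs
  imports "HOL-Analysis.Analysis"
begin

section \<open>Separation of sets and purity of domains\<close>

text \<open>The order on sets uses the convention that the maximum and the minimum of the empty set
  are 0 (ground sets are \<open>{1..n}\<close>). In particular the empty set is below every nonempty
  subset of \<open>{1..n}\<close>, so comparable sets are strongly separated.\<close>

definition max0 :: "nat set \<Rightarrow> nat" where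
  "max0 A = (if A = {} then 0 else Max A)"

definition min0 :: "nat set \<Rightarrow> nat" where
  "min0 A = (if A = {} then 0 else Min A)"

definition set_below :: "nat set \<Rightarrow> nat set \<Rightarrow> bool" where
  "set_below A B \<longleftrightarrow> max0 A < min0 B"

definition strongly_separated :: "nat set \<Rightarrow> nat set \<Rightarrow> bool" where
  "strongly_separated A B \<longleftrightarrow> A = B \<or> set_below (A - B) (B - A) \<or> set_below (B - A) (A - B)"

definition surrounds :: "nat set \<Rightarrow> nat set \<Rightarrow> bool" where
  "surrounds A B \<longleftrightarrow> \<not> (\<exists>i j k. i < j \<and> j < k \<and> i \<in> B - A \<and> k \<in> B - A \<and> j \<in> A - B)"

definition weakly_separated :: "nat set \<Rightarrow> nat set \<Rightarrow> bool" where
  "weakly_separated A B \<longleftrightarrow>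
     (card A \<le> card B \<and> surrounds A B) \<or> (card B \<le> card A \<and> surrounds B A)"

definition s_collection :: "nat set set \<Rightarrow> bool" where
  "s_collection \<C> \<longleftrightarrow> (\<forall>A\<in>\<C>. \<forall>B\<in>\<C>. strongly_separated A B)"

definition w_collection :: "nat set set \<Rightarrow> bool" where
  "w_collection \<C> \<longleftrightarrow> (\<forall>A\<in>\<C>. \<forall>B\<in>\<C>. weakly_separated A B)"

definition maximal_within :: "(nat set set \<Rightarrow> bool) \<Rightarrow> nat set set \<Rightarrow> nat set set \<Rightarrow> bool" where
  "maximal_within P \<D> \<C> \<longleftrightarrow>
     \<C> \<subseteq> \<D> \<and> P \<C> \<and> (\<forall>\<C>'. \<C> \<subseteq> \<C>' \<and> \<C>' \<subseteq> \<D> \<and> P \<C>' \<longrightarrow> \<C>' = \<C>)"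

definition s_pure :: "nat set set \<Rightarrow> bool" where
  "s_pure \<D> \<longleftrightarrow>
     (\<forall>\<C> \<C>'. maximal_within s_collection \<D> \<C> \<and> maximal_within s_collection \<D> \<C>' \<longrightarrow> card \<C> = card \<C>')"

definition w_pure :: "nat set set \<Rightarrow> bool" where
  "w_pure \<D> \<longleftrightarrow>
     (\<forall>\<C> \<C>'. maximal_within w_collection \<D> \<C> \<and> maximal_within w_collection \<D> \<C>' \<longrightarrow> card \<C> = card \<C>')"


section \<open>Cyclic zonotopes and cubillages in dimension 3\<close>

text \<open>Admissible generators \<open>\<theta> i = (x i, y i, 1)\<close>. The third condition says that, for
  \<open>i < j < k\<close>, the point \<open>(x j, y j)\<close> lies strictly below the segment joining
  \<open>(x i, y i)\<close> and \<open>(x k, y k)\<close>; its right-hand side is the height of that segment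
  at \<open>x j\<close>.\<close>

definition cyclic_generators :: "nat \<Rightarrow> (nat \<Rightarrow> real^3) \<Rightarrow> bool" where
  "cyclic_generators n \<theta> \<longleftrightarrow>
     (\<forall>i\<in>{1..n}. \<theta> i $ 3 = 1) \<and>
     (\<forall>i\<in>{1..n}. \<forall>j\<in>{1..n}. i < j \<longrightarrow> \<theta> i $ 1 < \<theta> j $ 1) \<and>
     (\<forall>i\<in>{1..n}. \<forall>j\<in>{1..n}. \<forall>k\<in>{1..n}. i < j \<and> j < k \<longrightarrow>
        \<theta> j $ 2 < ((\<theta> k $ 1 - \<theta> j $ 1) * \<theta> i $ 2 + (\<theta> j $ 1 - \<theta> i $ 1) * \<theta> k $ 2)
                   / (\<theta> k $ 1 - \<theta> i $ 1)) \<and>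
     (\<forall>c :: nat \<Rightarrow> int. (\<Sum>i\<in>{1..n}. of_int (c i) *\<^sub>R \<theta> i) = 0 \<longrightarrow> (\<forall>i\<in>{1..n}. c i = 0))"

text \<open>The sum below is the Minkowski sum of sets.\<close>

definition zonotope :: "nat \<Rightarrow> (nat \<Rightarrow> real^3) \<Rightarrow> (real^3) set" where
  "zonotope n \<theta> = (\<Sum>i\<in>{1..n}. closed_segment 0 (\<theta> i))"

definition point_of :: "(nat \<Rightarrow> real^3) \<Rightarrow> nat set \<Rightarrow> real^3" where
  "point_of \<theta> X = (\<Sum>i\<in>X. \<theta> i)"

definition cube :: "(nat \<Rightarrow> real^3) \<Rightarrow> nat set \<Rightarrow> nat \<Rightarrow> nat \<Rightarrow> nat \<Rightarrow> (real^3) set" where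
  "cube \<theta> X i j k =
     {point_of \<theta> X + (a *\<^sub>R \<theta> i + b *\<^sub>R \<theta> j + c *\<^sub>R \<theta> k) | a b c.
        0 \<le> a \<and> a \<le> 1 \<and> 0 \<le> b \<and> b \<le> 1 \<and> 0 \<le> c \<and> c \<le> 1}"

definition is_cube :: "nat \<Rightarrow> (nat \<Rightarrow> real^3) \<Rightarrow> (real^3) set \<Rightarrow> bool" where
  "is_cube n \<theta> C \<longleftrightarrow>
     (\<exists>X i j k. {i, j, k} \<subseteq> {1..n} \<and> i < j \<and> j < k \<and> X \<subseteq> {1..n} - {i, j, k} \<and> C = cube \<theta> X i j k)"

text \<open>A cubillage is represented by the set of its cubes. Since \<open>(face_of)\<close> counts the empty
  set as a face, disjoint cubes satisfy the condition on intersections.\<close>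

definition cubillage :: "nat \<Rightarrow> (nat \<Rightarrow> real^3) \<Rightarrow> (real^3) set set \<Rightarrow> bool" where
  "cubillage n \<theta> Q \<longleftrightarrow>
     (\<forall>C\<in>Q. is_cube n \<theta> C) \<and>
     \<Union>Q = zonotope n \<theta> \<and>
     (\<forall>C\<in>Q. \<forall>D\<in>Q. (C \<inter> D) face_of C \<and> (C \<inter> D) face_of D) \<and>
     (\<forall>F. F face_of zonotope n \<theta> \<and> F \<subseteq> frontier (zonotope n \<theta>) \<longrightarrow> (\<exists>C\<in>Q. F face_of C))"

text \<open>The vertices of the cubes, as subsets of \<open>{1..n}\<close>; for admissible generators
  \<open>point_of \<theta>\<close> is injective on these subsets because of integral independence.\<close>

definition cubillage_vertices :: "nat \<Rightarrow> (nat \<Rightarrow> real^3) \<Rightarrow> (real^3) set set \<Rightarrow> nat set set" where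
  "cubillage_vertices n \<theta> Q = {X. X \<subseteq> {1..n} \<and> (\<exists>C\<in>Q. point_of \<theta> X extreme_point_of C)}"

end

theory Submission
  imports Defs
begin

text \<open>Points of \<open>Z(4,3)\<close> are written \<open>\<Sum> t\<^sub>i \<theta>\<^sub>i\<close> with \<open>t\<close> in the unit 4-cube; two such \<open>t\<close> give
  the same point iff they differ by a multiple of the single linear dependency \<open>d\<close> of the
  generators, whose signs alternate. Hence a subset other than \<open>{1,3}\<close> and \<open>{2,4}\<close> is an
  extreme point of \<open>Z\<close>, so a vertex of every cubillage. The cubes are the images of the facets
  \<open>t\<^sub>l = b\<close> of the 4-cube. If \<open>{1,3}\<close> and \<open>{2,4}\<close> were both vertices, all four cubes around
  \<open>{2,4}\<close> would occur; one of them contains the point \<open>{1,3}\<close> without having it as a vertex,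
  so it cannot meet the cubes at \<open>{1,3}\<close> face to face. Thus the vertices are all subsets
  except \<open>{2,4}\<close>. There, \<open>{{2}, {1,2,4}}\<close> and \<open>{{2}, {3}, {2,3}}\<close>, together with the eight sets
  separated from everything, are maximal collections in both senses.\<close>

section \<open>Separation of sets and the two maximal collections\<close>

text \<open>When one difference lies entirely below the other, their elements cannot alternate, so
  each set surrounds the other and the comparison of cardinalities does not matter.\<close>

lemma strongly_imp_weakly_separated:
  assumes "finite A" "finite B" "strongly_separated A B"
  shows "weakly_separated A B"
proof -
  have sur: "surrounds A B \<and> surrounds B A" if "finite A" "finite B" "set_below (A - B) (B - A)" for A B
  proof -
    have "x < y" if "x \<in> A - B" "y \<in> B - A" for x y
    proof -
      have "x \<le> max0 (A - B)" "min0 (B - A) \<le> y"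
        using that \<open>finite A\<close> \<open>finite B\<close> by (auto simp: max0_def min0_def)
      then show ?thesis
        using \<open>set_below (A - B) (B - A)\<close> by (simp add: set_below_def)
    qed
    then show ?thesis
      unfolding surrounds_def by (meson less_asym)
  qed
  have "surrounds A B \<and> surrounds B A"
    using assms(3) unfolding strongly_separated_def
  proof (elim disjE)
    show "surrounds A B \<and> surrounds B A" if "A = B"
      using that by (simp add: surrounds_def)
  qed (use assms(1,2) sur in blast)+
  then show ?thesis
    unfolding weakly_separated_def by linarith
qed

lemma maximal_within_pairwise:
  assumes "\<C> \<subseteq> \<D>" "\<forall>A\<in>\<C>. \<forall>B\<in>\<C>. R A B" "\<forall>A\<in>\<D> - \<C>. \<exists>B\<in>\<C>. \<not> R A B"
  shows "maximal_within (\<lambda>\<C>. \<forall>A\<in>\<C>. \<forall>B\<in>\<C>. R A B) \<D> \<C>"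
  using assms unfolding maximal_within_def by blast

text \<open>Since strong separation implies weak separation, a collection that is strongly separated
  inside and fails even weak separation against every outsider is maximal in both senses. One pair
  of different sizes thus refutes both purities.\<close>

lemma not_pure:
  assumes C: "\<C>\<^sub>1 \<subseteq> \<D>" "\<C>\<^sub>2 \<subseteq> \<D>" "card \<C>\<^sub>1 \<noteq> card \<C>\<^sub>2"
    and fin: "\<forall>A\<in>\<D>. finite A"
    and s: "s_collection \<C>\<^sub>1" "s_collection \<C>\<^sub>2"
    and max: "\<forall>A\<in>\<D> - \<C>\<^sub>1. \<exists>B\<in>\<C>\<^sub>1. \<not> weakly_separated A B"
             "\<forall>A\<in>\<D> - \<C>\<^sub>2. \<exists>B\<in>\<C>\<^sub>2. \<not> weakly_separated A B"
  shows "\<not> s_pure \<D> \<and> \<not> w_pure \<D>"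
proof -
  have "maximal_within s_collection \<D> \<C> \<and> maximal_within w_collection \<D> \<C>"
    if "\<C> \<subseteq> \<D>" "s_collection \<C>" "\<forall>A\<in>\<D> - \<C>. \<exists>B\<in>\<C>. \<not> weakly_separated A B" for \<C>
  proof -
    have imp: "weakly_separated A B" if "A \<in> \<D>" "B \<in> \<D>" "strongly_separated A B" for A B
      using that fin strongly_imp_weakly_separated by blast
    have "\<forall>A\<in>\<C>. \<forall>B\<in>\<C>. strongly_separated A B"
      using that(2) by (simp add: s_collection_def)
    moreover have "\<forall>A\<in>\<D> - \<C>. \<exists>B\<in>\<C>. \<not> strongly_separated A B"
      using that(1,3) imp by (meson DiffD1 subsetD)
    moreover have "\<forall>A\<in>\<C>. \<forall>B\<in>\<C>. weakly_separated A B"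
      using calculation(1) that(1) imp by blast
    ultimately show ?thesis
      using that maximal_within_pairwise[of \<C> \<D> strongly_separated]
        maximal_within_pairwise[of \<C> \<D> weakly_separated]
      unfolding s_collection_def[abs_def] w_collection_def[abs_def] by blast
  qed
  then show ?thesis
    using assms unfolding s_pure_def w_pure_def by blast
qed

text \<open>Bounded quantifiers let the simplifier decide separation of explicit sets. Excluding 0
  puts the empty set below every nonempty one.\<close>

lemma strongly_separated_iff:
  assumes "finite A" "finite B" "0 \<notin> A" "0 \<notin> B"
  shows "strongly_separated A B \<longleftrightarrow>
    (\<forall>x\<in>A. x \<notin> B \<longrightarrow> (\<forall>y\<in>B. y \<notin> A \<longrightarrow> x < y)) \<or> (\<forall>x\<in>A. x \<notin> B \<longrightarrow> (\<forall>y\<in>B. y \<notin> A \<longrightarrow> y < x))"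
proof -
  have below: "set_below A B \<longleftrightarrow> B \<noteq> {} \<and> (\<forall>x\<in>A. \<forall>y\<in>B. x < y)"
    if "finite A" "finite B" "0 \<notin> A" "0 \<notin> B" for A B
  proof (cases "A = {} \<or> B = {}")
    case True
    then show ?thesis
      using that by (auto simp: set_below_def max0_def min0_def Min_gr_iff intro: gr0I)
  next
    case False
    then show ?thesis
      using that by (auto simp: set_below_def max0_def min0_def Min_gr_iff)
  qed
  have "set_below (A - B) (B - A) \<longleftrightarrow> B - A \<noteq> {} \<and> (\<forall>x\<in>A - B. \<forall>y\<in>B - A. x < y)"
       "set_below (B - A) (A - B) \<longleftrightarrow> A - B \<noteq> {} \<and> (\<forall>x\<in>B - A. \<forall>y\<in>A - B. x < y)"
    using assms by (intro below; simp)+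
  then show ?thesis
    unfolding strongly_separated_def by blast
qed

lemma surrounds_iff:
  "surrounds A B \<longleftrightarrow>
    (\<forall>i\<in>B. i \<notin> A \<longrightarrow> (\<forall>k\<in>B. k \<notin> A \<longrightarrow> (\<forall>j\<in>A. j \<notin> B \<longrightarrow> \<not> (i < j \<and> j < k))))"
  unfolding surrounds_def by blast

lemma not_pure_Pow4_minus_24:
  "\<not> s_pure (Pow {1..4} - {{2, 4}}) \<and> \<not> w_pure (Pow {1..4} - {{2, 4}})"
proof (rule not_pure)
  let ?I = "{{}, {1}, {4}, {1,2}, {3,4}, {1,2,3}, {2,3,4}, {1,2,3,4}} :: nat set set"
  let ?C = "?I \<union> {{2}, {1,2,4}}" and ?D = "?I \<union> {{2}, {3}, {2,3}}"
  have P: "Pow {1..4} - {{2, 4}} = ?I \<union> {{2}, {3}, {1,3}, {1,4}, {2,3}, {1,2,4}, {1,3,4}}"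
    by code_simp
  show "?C \<subseteq> Pow {1..4} - {{2, 4}}" "?D \<subseteq> Pow {1..4} - {{2, 4}}"
    unfolding P by simp_all
  show "card ?C \<noteq> card ?D"
    by code_simp
  show "\<forall>A\<in>Pow {1..4} - {{2, 4}}. finite (A :: nat set)"
    by (auto intro: finite_subset)
  show "s_collection ?C" "s_collection ?D"
    unfolding s_collection_def by (simp_all add: strongly_separated_iff)
  \<comment> \<open>\<open>{2}\<close> rules out \<open>{1,3}\<close>, \<open>{1,4}\<close> and
    \<open>{1,3,4}\<close>; \<open>{1,2,4}\<close> rules out \<open>{3}\<close> and
    \<open>{2,3}\<close>.\<close>
  have "\<forall>A\<in>Pow {1..4} - {{2, 4}}. A \<in> ?C \<or> \<not> weakly_separated A {2} \<or> \<not> weakly_separated A {1,2,4}"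
    unfolding P by (simp add: weakly_separated_def surrounds_iff)
  then show "\<forall>A\<in>(Pow {1..4} - {{2, 4}}) - ?C. \<exists>B\<in>?C. \<not> weakly_separated A B"
    by (metis DiffE UnCI insertCI)
  \<comment> \<open>\<open>{2}\<close> rules out the same three sets as before; \<open>{3}\<close>
    rules out \<open>{1,2,4}\<close>.\<close>
  have "\<forall>A\<in>Pow {1..4} - {{2, 4}}. A \<in> ?D \<or> \<not> weakly_separated A {2} \<or> \<not> weakly_separated A {3}"
    unfolding P by (simp add: weakly_separated_def surrounds_iff)
  then show "\<forall>A\<in>(Pow {1..4} - {{2, 4}}) - ?D. \<exists>B\<in>?D. \<not> weakly_separated A B"
    by (metis DiffE UnCI insertCI)
qed

section \<open>Combinations of the generators, the zonotope and its cubes\<close>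

definition comb :: "nat \<Rightarrow> (nat \<Rightarrow> 'a::real_vector) \<Rightarrow> (nat \<Rightarrow> real) \<Rightarrow> 'a" where
  "comb n \<theta> t = (\<Sum>i\<in>{1..n}. t i *\<^sub>R \<theta> i)"

lemma comb_add: "comb n \<theta> (\<lambda>i. s i + t i) = comb n \<theta> s + comb n \<theta> t"
  by (simp add: comb_def scaleR_left_distrib sum.distrib)

lemma comb_diff: "comb n \<theta> (\<lambda>i. s i - t i) = comb n \<theta> s - comb n \<theta> t"
  by (simp add: comb_def scaleR_left_diff_distrib sum_subtractf)

lemma comb_scale: "comb n \<theta> (\<lambda>i. c * t i) = c *\<^sub>R comb n \<theta> t"
  by (simp add: comb_def scaleR_sum_right)

lemma comb_cong: "(\<And>i. i \<in> {1..n} \<Longrightarrow> s i = t i) \<Longrightarrow> comb n \<theta> s = comb n \<theta> t"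
  unfolding comb_def by (rule sum.cong) auto

lemma comb_unit:
  assumes "i \<in> {1..n}"
  shows "comb n \<theta> (\<lambda>j. if j = i then c else 0) = c *\<^sub>R \<theta> i"
proof -
  have "comb n \<theta> (\<lambda>j. if j = i then c else 0) = (\<Sum>j\<in>{1..n}. if j = i then c *\<^sub>R \<theta> j else 0)"
    unfolding comb_def by (rule sum.cong) auto
  then show ?thesis
    using assms by simp
qed

lemma comb_indicator:
  assumes "X \<subseteq> {1..n}"
  shows "comb n \<theta> (indicator X) = point_of \<theta> X"
proof -
  have "comb n \<theta> (indicator X) = (\<Sum>i\<in>{1..n}. if i \<in> X then \<theta> i else 0)"
    unfolding comb_def by (rule sum.cong) (auto simp: indicator_def)
  also have "\<dots> = point_of \<theta> X"
    using assms unfolding point_of_def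
    by (simp add: sum.If_cases Int_absorb1)
  finally show ?thesis .
qed

definition unit_box :: "nat \<Rightarrow> (nat \<Rightarrow> real) set" where
  "unit_box n = {t. \<forall>i\<in>{1..n}. 0 \<le> t i \<and> t i \<le> 1}"

lemma indicator_unit_box: "indicator X \<in> unit_box n"
  by (simp add: unit_box_def indicator_def)

lemma zonotope_eq_comb: "zonotope n \<theta> = comb n \<theta> ` unit_box n"
proof -
  have *: "zonotope n \<theta> = {sum s {1..n} |s. \<forall>i\<in>{1..n}. s i \<in> closed_segment 0 (\<theta> i)}"
    unfolding zonotope_def by (subst set_sum_alt) auto
  show ?thesis
  proof
    show "zonotope n \<theta> \<subseteq> comb n \<theta> ` unit_box n"
    proof
      fix p assume "p \<in> zonotope n \<theta>"
      then obtain s where p: "p = sum s {1..n}" and s: "\<forall>i\<in>{1..n}. s i \<in> closed_segment 0 (\<theta> i)"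
        unfolding * by blast
      have "\<forall>i\<in>{1..n}. \<exists>u. 0 \<le> u \<and> u \<le> 1 \<and> s i = u *\<^sub>R \<theta> i"
        using s by (auto simp: in_segment)
      then obtain t where t: "\<forall>i\<in>{1..n}. 0 \<le> t i \<and> t i \<le> 1 \<and> s i = t i *\<^sub>R \<theta> i"
        by metis
      then have "p = comb n \<theta> t"
        unfolding p comb_def by (intro sum.cong) auto
      then show "p \<in> comb n \<theta> ` unit_box n"
        using t by (auto simp: unit_box_def)
    qed
    show "comb n \<theta> ` unit_box n \<subseteq> zonotope n \<theta>"
      unfolding * comb_def unit_box_def by (force simp: in_segment)
  qed
qed

text \<open>Facet of the unit \<open>n\<close>-cube, projected along \<open>comb\<close>; for \<open>n = 4\<close> these are exactly the cubes of
  the zonotope.\<close>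

definition facet :: "nat \<Rightarrow> (nat \<Rightarrow> 'a::real_vector) \<Rightarrow> nat \<Rightarrow> real \<Rightarrow> 'a set" where
  "facet n \<theta> l b = comb n \<theta> ` {t \<in> unit_box n. t l = b}"

lemma atLeastAtMost_1_4: "{1..4} = {1, 2, 3, 4::nat}"
  by auto

text \<open>Only one index \<open>l\<close> lies outside \<open>{i, j, k}\<close>, so
  \<open>X\<close> is empty or \<open>{l}\<close> and merely fixes the coefficient of
  \<open>\<theta> l\<close> at 0 or 1.\<close>

lemma is_cube_4_imp_facet:
  assumes "is_cube 4 \<theta> C"
  obtains l b where "l \<in> {1..4}" "b \<in> {0, 1}" "C = facet 4 \<theta> l b"
proof -
  obtain X i j k where ijk: "{i, j, k} \<subseteq> {1..4}" "i < j" "j < k"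
    and X: "X \<subseteq> {1..4} - {i, j, k}" and C: "C = cube \<theta> X i j k"
    using assms unfolding is_cube_def by blast
  have "\<exists>l. {1..4} = {i, j, k, l} \<and> l \<notin> {i, j, k}"
  proof -
    have c: "card {i, j, k} = 3"
      using ijk by simp
    have "card ({1..4} - {i, j, k}) = 1"
      using ijk(1) c by (simp add: card_Diff_subset)
    then obtain l where "{1..4} - {i, j, k} = {l}"
      by (meson card_1_singletonE)
    with ijk(1) show ?thesis
      by blast
  qed
  then obtain l where l: "{1..4} = {i, j, k, l}" "l \<notin> {i, j, k}"
    by blast
  have comb: "comb 4 \<theta> t = t l *\<^sub>R \<theta> l + (t i *\<^sub>R \<theta> i + t j *\<^sub>R \<theta> j + t k *\<^sub>R \<theta> k)" for t
    unfolding comb_def l(1) using l(2) ijk(2,3) by simp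
  define b :: real where "b = indicator X l"
  have "X \<subseteq> {l}"
    using X l by auto
  then have pt: "point_of \<theta> X = b *\<^sub>R \<theta> l"
    by (auto simp: subset_singleton_iff point_of_def b_def)
  have "C = facet 4 \<theta> l b"
  proof
    show "C \<subseteq> facet 4 \<theta> l b"
    proof
      fix p assume "p \<in> C"
      then obtain u v w where uvw: "0 \<le> u" "u \<le> 1" "0 \<le> v" "v \<le> 1" "0 \<le> w" "w \<le> 1"
        and p: "p = b *\<^sub>R \<theta> l + (u *\<^sub>R \<theta> i + v *\<^sub>R \<theta> j + w *\<^sub>R \<theta> k)"
        unfolding C cube_def pt by blast
      define t where "t = (\<lambda>x. if x = i then u else if x = j then v else if x = k then w else b)"
      have "t \<in> unit_box 4" "t l = b"
        using uvw l(2) by (auto simp: t_def unit_box_def b_def indicator_def)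
      moreover have "p = comb 4 \<theta> t"
        unfolding comb p using l(2) ijk(2,3) by (simp add: t_def)
      ultimately show "p \<in> facet 4 \<theta> l b"
        unfolding facet_def by blast
    qed
    show "facet 4 \<theta> l b \<subseteq> C"
      using ijk(1) unfolding facet_def C cube_def pt unit_box_def comb by blast
  qed
  moreover have "l \<in> {1..4}" "b \<in> {0, 1}"
    using l by (auto simp: b_def indicator_def)
  ultimately show thesis
    using that by blast
qed

lemma compact_cube: "compact (cube \<theta> X i j k)"
proof -
  have "cube \<theta> X i j k =
      (\<lambda>(a, b, c). point_of \<theta> X + (a *\<^sub>R \<theta> i + b *\<^sub>R \<theta> j + c *\<^sub>R \<theta> k)) ` ({0..1} \<times> {0..1} \<times> {0..1})"
    unfolding cube_def by (auto simp: image_iff; metis atLeastAtMost_iff)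
  moreover have "compact \<dots>"
    by (intro compact_continuous_image compact_Times compact_Icc)
       (auto intro!: continuous_intros simp: case_prod_beta)
  ultimately show ?thesis
    by simp
qed

text \<open>Face-to-face: a vertex of one cube of the cubillage is a vertex of every cube through it.\<close>

lemma cubillage_extreme_point:
  assumes "cubillage n \<theta> Q" "C \<in> Q" "D \<in> Q" "p extreme_point_of C" "p \<in> D"
  shows "p extreme_point_of D"
proof -
  have "(C \<inter> D) face_of D"
    using assms unfolding cubillage_def by blast
  moreover have "{p} face_of C"
    using assms by (simp add: face_of_singleton)
  then have "{p} face_of (C \<inter> D)"
    using assms(4,5) by (meson IntI Int_lower1 empty_subsetI extreme_point_of_def face_of_subset insert_subset)
  ultimately have "{p} face_of D"
    using face_of_trans by blast
  then show ?thesis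
    by (simp add: face_of_singleton)
qed

section \<open>Vertices of a cubillage when the generators have one dependency\<close>

text \<open>\<open>d\<close> spans the linear dependencies of the four generators; the alternating signs encode the
  convex position of the generators.\<close>

locale circuit4 =
  fixes \<theta> :: "nat \<Rightarrow> real^3" and d :: "nat \<Rightarrow> real"
  assumes comb_d: "comb 4 \<theta> d = 0"
    and d_pos: "d 1 > 0" "d 3 > 0"
    and d_neg: "d 2 < 0" "d 4 < 0"
    and kernel: "comb 4 \<theta> t = 0 \<Longrightarrow> \<exists>c. \<forall>i\<in>{1..4}. t i = c * d i"
    and inj: "inj_on (point_of \<theta>) (Pow {1..4})"
begin

lemma comb_eqD:
  assumes "comb 4 \<theta> s = comb 4 \<theta> t"
  obtains c where "\<And>i. i \<in> {1..4} \<Longrightarrow> s i = t i + c * d i"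
proof -
  have "comb 4 \<theta> (\<lambda>i. s i - t i) = 0"
    using assms by (simp add: comb_diff)
  then obtain c where "\<forall>i\<in>{1..4}. s i - t i = c * d i"
    using kernel by blast
  then show thesis
    by (intro that[of c]) (auto simp: algebra_simps)
qed

lemma d_nonzero: "i \<in> {1..4} \<Longrightarrow> d i \<noteq> 0"
  using d_pos d_neg unfolding atLeastAtMost_1_4 by auto

text \<open>A zero generator would give a dependency supported on one index, but every nonzero
  multiple of \<open>d\<close> has full support.\<close>

lemma theta_nonzero:
  assumes "i \<in> {1..4}"
  shows "\<theta> i \<noteq> 0"
proof
  assume "\<theta> i = 0"
  then have "comb 4 \<theta> (\<lambda>j. if j = i then 1 else 0) = 0"
    using comb_unit[OF assms, of \<theta> 1] by simp
  then obtain c where c: "\<forall>j\<in>{1..4}. (if j = i then 1 else 0) = c * d j"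
    using kernel by blast
  obtain j where "j \<in> {1..4}" "j \<noteq> i"
    using that[of 1] that[of 2] by fastforce
  then have "c = 0"
    using c d_nonzero by force
  then show False
    using c assms by force
qed

text \<open>A representation of the point in the unit box differs from the indicator of
  \<open>X\<close> by some \<open>c * d\<close>. If \<open>c\<close> is nonzero, the signs of
  \<open>d\<close> force \<open>X\<close> to be \<open>{1, 3}\<close> or \<open>{2, 4}\<close>;
  otherwise the indicator is the only representation, and it is a corner of the box.\<close>

lemma extreme_point_of_zonotope:
  assumes X: "X \<subseteq> {1..4}" "X \<noteq> {1, 3}" "X \<noteq> {2, 4}"
  shows "point_of \<theta> X extreme_point_of zonotope 4 \<theta>"
  unfolding extreme_point_of_def
proof (intro conjI ballI notI)
  show "point_of \<theta> X \<in> zonotope 4 \<theta>"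
    unfolding zonotope_eq_comb comb_indicator[OF X(1), symmetric]
    using indicator_unit_box by blast
  fix a b
  assume "a \<in> zonotope 4 \<theta>" "b \<in> zonotope 4 \<theta>" and seg: "point_of \<theta> X \<in> open_segment a b"
  then obtain s t where s: "s \<in> unit_box 4" "a = comb 4 \<theta> s" and t: "t \<in> unit_box 4" "b = comb 4 \<theta> t"
    unfolding zonotope_eq_comb by blast
  obtain u where u: "0 < u" "u < 1" and p: "point_of \<theta> X = (1 - u) *\<^sub>R a + u *\<^sub>R b" and "a \<noteq> b"
    using seg by (auto simp: in_segment)
  define r where "r = (\<lambda>i. (1 - u) * s i + u * t i)"
  have "comb 4 \<theta> r = comb 4 \<theta> (indicator X)"
    unfolding r_def comb_add comb_scale comb_indicator[OF X(1)] p s t ..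
  then obtain c where c: "\<And>i. i \<in> {1..4} \<Longrightarrow> r i = indicator X i + c * d i"
    using comb_eqD by blast
  have r: "0 \<le> r i \<and> r i \<le> 1" if "i \<in> {1..4}" for i
  proof -
    have st: "0 \<le> s i" "s i \<le> 1" "0 \<le> t i" "t i \<le> 1"
      using s(1) t(1) that by (auto simp: unit_box_def)
    then have "(1 - u) * s i + u * t i \<le> 1"
      using u by (intro convex_bound_le) auto
    then show ?thesis
      using st u by (simp add: r_def)
  qed
  have "c = 0"
  proof (rule ccontr)
    assume "c \<noteq> 0"
    \<comment> \<open>A coordinate equal to 1 can only decrease inside the box, and one equal to 0
      can only increase.\<close>
    have mem: "i \<in> X \<longleftrightarrow> c * d i < 0" if "i \<in> {1..4}" for i
    proof -
      have "c * d i \<noteq> 0"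
        using \<open>c \<noteq> 0\<close> d_nonzero[OF that] by simp
      then show ?thesis
        using r[OF that] c[OF that] by (cases "i \<in> X") (auto simp: less_le)
    qed
    have "X = {i \<in> {1..4}. c * d i < 0}"
      using mem X(1) by blast
    also have "\<dots> = {2, 4} \<or> \<dots> = {1, 3}"
      using d_pos d_neg \<open>c \<noteq> 0\<close> unfolding atLeastAtMost_1_4
      by (cases "c > 0") (auto simp: mult_less_0_iff)
    finally show False
      using X by blast
  qed
  have "s i = t i" if "i \<in> {1..4}" for i
  proof -
    have st: "0 \<le> s i" "s i \<le> 1" "0 \<le> t i" "t i \<le> 1"
      using s(1) t(1) that by (auto simp: unit_box_def)
    have eq: "(1 - u) * s i + u * t i = indicator X i"
      using c[OF that] \<open>c = 0\<close> by (simp add: r_def)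
    show ?thesis
    proof (cases "i \<in> X")
      case True
      then have "(1 - u) * (1 - s i) + u * (1 - t i) = 0"
        using eq by (simp add: algebra_simps)
      then show ?thesis
        using u st by (simp add: add_nonneg_eq_0_iff)
    next
      case False
      then show ?thesis
        using u st eq by (simp add: add_nonneg_eq_0_iff)
    qed
  qed
  then have "a = b"
    unfolding s t by (rule comb_cong)
  with \<open>a \<noteq> b\<close> show False ..
qed

text \<open>A fractional coordinate could be moved both ways inside the facet, so an extreme point
  has a 0/1 representation; injectivity of \<open>point_of\<close> identifies it with
  \<open>X\<close>.\<close>

lemma extreme_point_of_facet:
  assumes X: "X \<subseteq> {1..4}" and l: "l \<in> {1..4}" and b: "b \<in> {0, 1}"
    and ext: "point_of \<theta> X extreme_point_of facet 4 \<theta> l b"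
  shows "b = indicator X l"
proof -
  obtain t where t: "t \<in> unit_box 4" "t l = b" "point_of \<theta> X = comb 4 \<theta> t"
    using ext unfolding extreme_point_of_def facet_def by blast
  have t01: "t i \<in> {0, 1}" if i: "i \<in> {1..4}" for i
  proof (rule ccontr)
    assume "t i \<notin> {0, 1}"
    then have ti: "0 < t i" "t i < 1"
      using t(1) i by (auto simp: unit_box_def less_le)
    have "i \<noteq> l"
      using t(2) b \<open>t i \<notin> {0, 1}\<close> by auto
    define e where "e = min (t i) (1 - t i)"
    have e: "0 < e" "e \<le> t i" "t i + e \<le> 1"
      using ti by (auto simp: e_def)
    define p where "p = (\<lambda>c. comb 4 \<theta> t + c *\<^sub>R \<theta> i)"
    have p: "p c \<in> facet 4 \<theta> l b" if "c = e \<or> c = - e" for c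
    proof -
      have "p c = comb 4 \<theta> (\<lambda>j. t j + (if j = i then c else 0))"
        by (simp only: p_def comb_add comb_unit[OF i])
      moreover have "(\<lambda>j. t j + (if j = i then c else 0)) \<in> {t \<in> unit_box 4. t l = b}"
        using that t(1,2) e \<open>i \<noteq> l\<close> by (auto simp: unit_box_def)
      ultimately show ?thesis
        unfolding facet_def by blast
    qed
    have "p (- e) \<noteq> p e"
      unfolding p_def add_left_cancel scaleR_cancel_right using e theta_nonzero[OF i] by simp
    then have "midpoint (p (- e)) (p e) \<in> open_segment (p (- e)) (p e)"
      by simp
    moreover have "midpoint (p (- e)) (p e) = point_of \<theta> X"
      unfolding p_def t(3) by (simp add: midpoint_eq_iff)
    ultimately show False
      using ext p unfolding extreme_point_of_def by metis
  qed
  define Y where "Y = {i \<in> {1..4}. t i = 1}"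
  have tY: "t i = indicator Y i" if "i \<in> {1..4}" for i
    using t01[OF that] that by (auto simp: Y_def indicator_def)
  have Y: "Y \<subseteq> {1..4}"
    by (auto simp: Y_def)
  have "point_of \<theta> X = comb 4 \<theta> (indicator Y)"
    unfolding t(3) using tY by (rule comb_cong)
  then have "X = Y"
    using inj X Y unfolding comb_indicator[OF Y] by (auto dest: inj_onD)
  then show ?thesis
    using tY[OF l] t(2) by simp
qed

text \<open>The contradiction comes from a coordinate \<open>m\<close> with
  \<open>\<bar>d m\<bar>\<close> maximal: the cube at \<open>{2, 4}\<close> fixing that coordinate
  contains the point \<open>{1, 3}\<close>, whose own coordinate \<open>m\<close> has the opposite
  value.\<close>

lemma not_13_and_24:
  assumes Q: "cubillage 4 \<theta> Q"
    and V: "{1, 3} \<in> cubillage_vertices 4 \<theta> Q" "{2, 4} \<in> cubillage_vertices 4 \<theta> Q"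
  shows False
proof -
  let ?p = "point_of \<theta> {1, 3}" and ?q = "point_of \<theta> {2, 4}"
  have sub: "{1, 3} \<subseteq> {1..4::nat}" "{2, 4} \<subseteq> {1..4::nat}"
    by auto
  obtain C D where C: "C \<in> Q" "?p extreme_point_of C" and D: "D \<in> Q" "?q extreme_point_of D"
    using V unfolding cubillage_vertices_def by blast
  have cubes: "\<forall>E\<in>Q. is_cube 4 \<theta> E" and UQ: "\<Union>Q = zonotope 4 \<theta>"
    using Q unfolding cubillage_def by blast+
  \<comment> \<open>The signs of \<open>d\<close> point from the corner \<open>{2, 4}\<close> into
    the unit box in every coordinate.\<close>
  have ind24: "indicator {2, 4} i + x * sgn (d i) = (if d i > 0 then x else 1 - x)"
    if "i \<in> {1..4}" for i and x :: real
    using that d_pos d_neg unfolding atLeastAtMost_1_4 by auto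
  have ind13: "indicator {1, 3} i = (if d i > 0 then 1 else 0 :: real)"
    if "i \<in> {1..4}" for i
    using that d_pos d_neg unfolding atLeastAtMost_1_4 by auto
  obtain m where m: "m \<in> {1..4}" "\<And>i. i \<in> {1..4} \<Longrightarrow> \<bar>d i\<bar> \<le> \<bar>d m\<bar>"
  proof -
    let ?A = "(\<lambda>i. \<bar>d i\<bar>) ` {1..4}"
    have "Max ?A \<in> ?A"
      by (rule Max_in) auto
    then obtain m where "m \<in> {1..4}" "Max ?A = \<bar>d m\<bar>"
      by (rule imageE)
    moreover have "\<bar>d i\<bar> \<le> Max ?A" if "i \<in> {1..4}" for i
      using that by (intro Max_ge) auto
    ultimately show thesis
      using that by metis
  qed
  txt \<open>Maximality of \<open>\<bar>d m\<bar>\<close> makes \<open>m\<close> the first coordinate to leave the unit interval on the line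
    from \<open>{1,3}\<close> in direction \<open>-d\<close>, so \<open>{1,3}\<close> lies in this cube.\<close>
  have "facet 4 \<theta> m (indicator {2, 4} m) \<in> Q"
  proof -
    txt \<open>Moving from \<open>{2,4}\<close> into the interior of the cube \<open>t\<^sub>m = b\<close>: the only cube at \<open>{2,4}\<close> met
      in this direction is that one.\<close>
    define e where "e = (\<lambda>i. if i = m then 0 else sgn (d i))"
    define q where "q = (\<lambda>x. ?q + x *\<^sub>R comb 4 \<theta> e)"
    have q_comb: "q x = comb 4 \<theta> (\<lambda>i. indicator {2, 4} i + x * e i)" for x
      by (simp only: q_def comb_add comb_scale comb_indicator[OF sub(2)])
    \<comment> \<open>Finitely many closed cubes miss \<open>?q\<close>, so for small
      \<open>x > 0\<close> every cube through \<open>q x\<close> also contains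
      \<open>?q\<close>.\<close>
    let ?U = "\<Union>{E \<in> Q. ?q \<notin> E}"
    have "Q \<subseteq> (\<lambda>(l, b). facet 4 \<theta> l b) ` ({1..4} \<times> {0, 1})"
      using cubes by (force elim: is_cube_4_imp_facet)
    then have "finite Q"
      by (rule finite_subset) auto
    have "closed E" if "E \<in> Q" for E
      using cubes that compact_cube compact_imp_closed unfolding is_cube_def by metis
    then have "closed ?U"
      using \<open>finite Q\<close> by (intro closed_Union) auto
    then have "open (- ?U)"
      by (simp add: open_closed)
    moreover have "(q \<longlongrightarrow> q 0) (at_right 0)"
      unfolding q_def by (intro tendsto_intros)
    moreover have "q 0 \<in> - ?U"
      by (simp add: q_def)
    ultimately have "\<forall>\<^sub>F x in at_right 0. q x \<in> - ?U"
      using topological_tendstoD by blast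
    moreover have "\<forall>\<^sub>F x :: real in at_right 0. 0 < x \<and> x < 1"
      by (intro eventually_conj eventually_at_right_less eventually_at_rightI[of 0 1]) auto
    ultimately obtain x where x: "0 < x" "x < 1" and xU: "q x \<notin> ?U"
      using eventually_happens[OF eventually_conj] by force
    have "(\<lambda>i. indicator {2, 4} i + x * e i) \<in> unit_box 4"
      unfolding unit_box_def
    proof (safe)
      fix i :: nat assume i: "i \<in> {1..4}"
      show "0 \<le> indicator {2, 4} i + x * e i" "indicator {2, 4} i + x * e i \<le> 1"
        using ind24[OF i, of x] x by (auto simp: e_def indicator_def split: if_splits)
    qed
    then have "q x \<in> \<Union>Q"
      unfolding UQ zonotope_eq_comb q_comb by blast
    then obtain E where E: "E \<in> Q" "q x \<in> E"
      by blast
    then have "?q extreme_point_of E"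
      using xU cubillage_extreme_point[OF Q D(1) E(1) D(2)] by blast
    obtain l b where l: "l \<in> {1..4}" "b \<in> {0, 1}" "E = facet 4 \<theta> l b"
      using cubes E(1) by (meson is_cube_4_imp_facet)
    then have b: "b = indicator {2, 4} l"
      using extreme_point_of_facet[OF sub(2)] \<open>?q extreme_point_of E\<close> by blast
    obtain s where s: "s \<in> unit_box 4" "s l = b" "q x = comb 4 \<theta> s"
      using E(2) unfolding l(3) facet_def by blast
    have "l = m"
    proof (rule ccontr)
      assume "l \<noteq> m"
      obtain c where c: "\<And>i. i \<in> {1..4} \<Longrightarrow> s i = indicator {2, 4} i + x * e i + c * d i"
        using s(3)[symmetric] unfolding q_comb using comb_eqD by blast
      \<comment> \<open>Coordinate \<open>l\<close> has moved inward by \<open>x\<close> and must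
        return to \<open>b\<close>, which makes \<open>c\<close> negative; coordinate
        \<open>m\<close>, still at its corner value, is then pushed out of the box.\<close>
      have "x * sgn (d l) + c * d l = 0"
        using c[OF l(1)] s(2) b \<open>l \<noteq> m\<close> by (simp add: e_def)
      then have "c < 0"
        using x d_nonzero[OF l(1)] mult_less_0_iff[of c "d l"] zero_less_mult_iff[of c "d l"]
        by (cases "d l > 0") auto
      have "s m = (if d m > 0 then 0 else 1) + c * d m"
        using c[OF m(1)] ind24[OF m(1), of 0] by (simp add: e_def)
      moreover have "0 \<le> s m" "s m \<le> 1"
        using s(1) m(1) by (auto simp: unit_box_def)
      ultimately show False
        using \<open>c < 0\<close> d_nonzero[OF m(1)]
        by (cases "d m > 0") (auto simp: zero_le_mult_iff mult_le_0_iff)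
    qed
    then show ?thesis
      using E(1) l(3) b by simp
  qed
  moreover have "?p \<in> facet 4 \<theta> m (indicator {2, 4} m)"
  proof -
    \<comment> \<open>This step length carries coordinate \<open>m\<close> exactly across the unit
      interval.\<close>
    define t where "t = (\<lambda>i. indicator {1, 3} i - (1 / \<bar>d m\<bar>) * d i)"
    have "comb 4 \<theta> t = ?p"
      by (simp only: t_def comb_diff comb_scale comb_d comb_indicator[OF sub(1)]) simp
    moreover have t: "t i = (if d i > 0 then 1 - \<bar>d i\<bar> / \<bar>d m\<bar> else \<bar>d i\<bar> / \<bar>d m\<bar>)"
      if "i \<in> {1..4}" for i
      unfolding t_def ind13[OF that] by simp
    moreover have "t \<in> unit_box 4"
      unfolding unit_box_def
    proof (safe)
      fix i :: nat assume i: "i \<in> {1..4}"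
      have "\<bar>d i\<bar> / \<bar>d m\<bar> \<le> 1"
        using m(2)[OF i] d_nonzero[OF m(1)] by (simp add: divide_le_eq)
      moreover have "0 \<le> \<bar>d i\<bar> / \<bar>d m\<bar>"
        by simp
      ultimately show "0 \<le> t i" "t i \<le> 1"
        by (auto simp: t[OF i])
    qed
    moreover have "t m = indicator {2, 4} m"
      using ind24[OF m(1), of 0] d_nonzero[OF m(1)] by (simp add: t[OF m(1)])
    ultimately show ?thesis
      unfolding facet_def by force
  qed
  ultimately have "?p extreme_point_of facet 4 \<theta> m (indicator {2, 4} m)"
    using cubillage_extreme_point[OF Q C(1) _ C(2)] by blast
  then have "indicator {2, 4} m = (indicator {1, 3} m :: real)"
    using m(1) by (intro extreme_point_of_facet[OF sub(1)]) (auto simp: indicator_def)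
  then show False
    using m(1) unfolding atLeastAtMost_1_4 by auto
qed

text \<open>An extreme point of the whole zonotope stays extreme in any cube containing it, which
  supplies every subset except the two exceptional ones.\<close>

lemma cubillage_vertices_13:
  assumes Q: "cubillage 4 \<theta> Q" and V: "{1, 3} \<in> cubillage_vertices 4 \<theta> Q"
  shows "cubillage_vertices 4 \<theta> Q = Pow {1..4} - {{2, 4}}"
proof -
  have UQ: "\<Union>Q = zonotope 4 \<theta>"
    using Q unfolding cubillage_def by blast
  have "X \<in> cubillage_vertices 4 \<theta> Q" if X: "X \<subseteq> {1..4}" "X \<noteq> {1, 3}" "X \<noteq> {2, 4}" for X
  proof -
    have ext: "point_of \<theta> X extreme_point_of \<Union>Q"
      unfolding UQ using X by (rule extreme_point_of_zonotope)
    then obtain C where "C \<in> Q" "point_of \<theta> X \<in> C"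
      unfolding extreme_point_of_def by blast
    with ext have "point_of \<theta> X extreme_point_of C"
      unfolding extreme_point_of_def by blast
    with \<open>C \<in> Q\<close> X(1) show ?thesis
      unfolding cubillage_vertices_def by blast
  qed
  moreover have "{2, 4} \<notin> cubillage_vertices 4 \<theta> Q"
    using not_13_and_24[OF Q V] by blast
  moreover have "cubillage_vertices 4 \<theta> Q \<subseteq> Pow {1..4}"
    unfolding cubillage_vertices_def by blast
  ultimately show ?thesis
    using V by blast
qed

end

section \<open>Determinants and the dependency of four cyclic generators\<close>

definition det3 :: "real^3 \<Rightarrow> real^3 \<Rightarrow> real^3 \<Rightarrow> real" where
  "det3 u v w = u$1 * (v$2 * w$3 - v$3 * w$2) - u$2 * (v$1 * w$3 - v$3 * w$1) + u$3 * (v$1 * w$2 - v$2 * w$1)"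

lemma det3_eq_0:
  assumes "a *\<^sub>R u + b *\<^sub>R v + c *\<^sub>R w = 0" "det3 u v w \<noteq> 0"
  shows "a = 0" "b = 0" "c = 0"
proof -
  have eq: "a * u$i + b * v$i + c * w$i = 0" for i
    using arg_cong[OF assms(1), of "\<lambda>x. x $ i"] by simp
  have "a * det3 u v w = 0" "b * det3 u v w = 0" "c * det3 u v w = 0"
    using eq[of 1] eq[of 2] eq[of 3] unfolding det3_def by algebra+
  with assms(2) show "a = 0" "b = 0" "c = 0"
    by auto
qed

text \<open>With third coordinates 1, the determinant is twice the signed area of the planar
  triangle, and the convexity condition is its positivity after clearing the denominator.\<close>

lemma det3_cyclic_generators_pos:
  assumes "cyclic_generators n \<theta>" "{i, j, k} \<subseteq> {1..n}" "i < j" "j < k"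
  shows "det3 (\<theta> i) (\<theta> j) (\<theta> k) > 0"
proof -
  have 3: "\<theta> i $ 3 = 1" "\<theta> j $ 3 = 1" "\<theta> k $ 3 = 1"
    and x: "\<theta> i $ 1 < \<theta> k $ 1"
    using assms unfolding cyclic_generators_def by auto
  have "\<theta> j $ 2 < ((\<theta> k $ 1 - \<theta> j $ 1) * \<theta> i $ 2 + (\<theta> j $ 1 - \<theta> i $ 1) * \<theta> k $ 2)
                   / (\<theta> k $ 1 - \<theta> i $ 1)"
    using assms unfolding cyclic_generators_def by auto
  then have "\<theta> j $ 2 * (\<theta> k $ 1 - \<theta> i $ 1) < (\<theta> k $ 1 - \<theta> j $ 1) * \<theta> i $ 2 + (\<theta> j $ 1 - \<theta> i $ 1) * \<theta> k $ 2"
    using x by (simp add: less_divide_eq)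
  then show ?thesis
    unfolding det3_def 3 by (simp add: algebra_simps)
qed

lemma comb_4: "comb 4 \<theta> t = t 1 *\<^sub>R \<theta> 1 + t 2 *\<^sub>R \<theta> 2 + t 3 *\<^sub>R \<theta> 3 + t 4 *\<^sub>R \<theta> 4"
  unfolding comb_def atLeastAtMost_1_4 by (simp add: add.assoc)

text \<open>The difference of two indicators has integer values, so integral independence
  applies.\<close>

lemma inj_on_point_of:
  assumes "cyclic_generators n \<theta>"
  shows "inj_on (point_of \<theta>) (Pow {1..n})"
proof (rule inj_onI)
  fix X Y assume XY: "X \<in> Pow {1..n}" "Y \<in> Pow {1..n}" and eq: "point_of \<theta> X = point_of \<theta> Y"
  have "comb n \<theta> (\<lambda>i. indicator X i - indicator Y i) = 0"
    using XY eq by (simp add: comb_diff comb_indicator)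
  moreover define c :: "nat \<Rightarrow> int" where "c = (\<lambda>i. indicator X i - indicator Y i)"
  ultimately have "(\<Sum>i\<in>{1..n}. of_int (c i) *\<^sub>R \<theta> i) = 0"
    unfolding comb_def by (simp add: indicator_def if_distrib cong: if_cong)
  then have "\<forall>i\<in>{1..n}. c i = 0"
    using assms unfolding cyclic_generators_def by blast
  then have "i \<in> X \<longleftrightarrow> i \<in> Y" if "i \<in> {1..n}" for i
    using that by (auto simp: c_def indicator_def split: if_splits dest!: bspec[of _ _ i])
  then show "X = Y"
    using XY by blast
qed

lemma circuit4_cyclic_generators:
  assumes "cyclic_generators 4 \<theta>"
  obtains d where "circuit4 \<theta> d"
proof -
  \<comment> \<open>The signed maximal minors of the 3 by 4 matrix of generators: Cramer's
    relation.\<close>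
  define d where "d = (\<lambda>i::nat.
    if i = 1 then det3 (\<theta> 2) (\<theta> 3) (\<theta> 4) else if i = 2 then - det3 (\<theta> 1) (\<theta> 3) (\<theta> 4)
    else if i = 3 then det3 (\<theta> 1) (\<theta> 2) (\<theta> 4) else - det3 (\<theta> 1) (\<theta> 2) (\<theta> 3))"
  have d: "d 1 = det3 (\<theta> 2) (\<theta> 3) (\<theta> 4)" "d 2 = - det3 (\<theta> 1) (\<theta> 3) (\<theta> 4)"
    "d 3 = det3 (\<theta> 1) (\<theta> 2) (\<theta> 4)" "d 4 = - det3 (\<theta> 1) (\<theta> 2) (\<theta> 3)"
    by (simp_all add: d_def)
  have pos: "d 1 > 0" "d 2 < 0" "d 3 > 0" "d 4 < 0"
    unfolding d using assms by (auto intro!: det3_cyclic_generators_pos)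
  have "comb 4 \<theta> d = 0"
    unfolding comb_4 d det3_def vec_eq_iff forall_3 by (simp add: algebra_simps)
  moreover have "\<exists>c. \<forall>i\<in>{1..4}. t i = c * d i" if "comb 4 \<theta> t = 0" for t
  proof -
    \<comment> \<open>Subtracting this multiple of \<open>d\<close> clears coordinate 1; the other
      three generators are independent because their determinant is \<open>d 1\<close>.\<close>
    define c where "c = t 1 / d 1"
    define s where "s = (\<lambda>i. t i - c * d i)"
    have "comb 4 \<theta> s = 0"
      unfolding s_def comb_diff comb_scale that \<open>comb 4 \<theta> d = 0\<close> by simp
    moreover have "s 1 = 0"
      using pos by (simp add: s_def c_def)
    ultimately have "s 2 *\<^sub>R \<theta> 2 + s 3 *\<^sub>R \<theta> 3 + s 4 *\<^sub>R \<theta> 4 = 0"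
      unfolding comb_4 by simp
    then have "s 2 = 0" "s 3 = 0" "s 4 = 0"
      using det3_eq_0 pos(1) unfolding d by (metis less_irrefl)+
    with \<open>s 1 = 0\<close> have "\<forall>i\<in>{1..4}. t i = c * d i"
      unfolding atLeastAtMost_1_4 by (simp add: s_def)
    then show ?thesis ..
  qed
  ultimately have "circuit4 \<theta> d"
    using pos inj_on_point_of[OF assms] by unfold_locales auto
  then show thesis
    by (rule that)
qed

theorem lemma3p1:
  fixes \<theta> :: "nat \<Rightarrow> real^3" and Q :: "(real^3) set set"
  assumes "cyclic_generators 4 \<theta>"
    and "cubillage 4 \<theta> Q"
    and "{1, 3} \<in> cubillage_vertices 4 \<theta> Q"
  shows "\<not> s_pure (cubillage_vertices 4 \<theta> Q) \<and> \<not> w_pure (cubillage_vertices 4 \<theta> Q)"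
proof -
  obtain d where "circuit4 \<theta> d"
    using assms(1) by (rule circuit4_cyclic_generators)
  then show ?thesis
    using circuit4.cubillage_vertices_13[OF _ assms(2,3)] not_pure_Pow4_minus_24 by metis
qed

end
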